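(* There are uncountably many distinct preservation consequence relations (i.e. the collection of all $\alpha$-preservation consequence relations, for $\alpha$ an upset, is uncountable), and any two distinct preservation consequence relations are incomparable.
   Context: Language: $\mathcal{L}$ is the propositional language with countably infinitely many atomic sentences and connectives $\neg,\lor$ (other classical connectives defined as usual). An argument $\Gamma\rhd\Delta$ is a pair of finite (possibly empty) sets $\Gamma,\Delta$ of sentences of $\mathcal{L}$. A probabilistic model is $\langle W,\mathcal{A},[\![\cdot]\!],P\rangle$ where $W$ is a nonempty set (of worlds); $\mathcal{A}\subseteq\mathcal{P}(W)$ contains $\emptyset$ and is closed under complement in $W$ and binary union; $[\![\cdot]\!]:\mathcal{L}\to\mathcal{A}$ satisfies $[\![\neg\phi]\!]=W\setminus[\![\phi]\!]$ and $[\![\phi\lor\psi]\!]=[\![\phi]\!]\cup[\![\psi]\!]$; and $P:\mathcal{A}\to[0,1]$ is a finitely additive probability ($P(\emptyset)=0$, $P(W\setminus A)=1-P(A)$, and $P(A\cup B)=P(A)+P(B)$ for disjoint $A,B\in\mathcal{A}$). Write $P(\phi)$ for $P([\![\phi]\!])$. An upset is a set $\alpha\subseteq[0,1]$ with $1\in\alpha$, $0\notin\alpha$, and such that $x\in\alpha$, $x\le y\le 1$ imply $y\in\alpha$. $\Gamma\rhd\Delta$ is $\alpha$-preservation valid iff in every probabilistic model, if $P(\gamma)\in\alpha$ for every $\gamma\in\Gamma$, then $P(\delta)\in\alpha$ for some $\delta\in\Delta$. The $\alpha$-preservation consequence relation is the set of $\alpha$-preservation valid arguments. Two consequence relations are distinct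 when they are distinct as sets, and incomparable when neither is a subset of the other. *)

theory Defs
  imports "HOL-Analysis.Analysis"
begin

datatype form = Atom nat | Neg form | Or form form

definition probabilistic_model ::
  "'w set \<Rightarrow> 'w set set \<Rightarrow> (form \<Rightarrow> 'w set) \<Rightarrow> ('w set \<Rightarrow> real) \<Rightarrow> bool"
where
  "probabilistic_model W \<A> V P \<longleftrightarrow>
     W \<noteq> {} \<and>
     algebra W \<A> \<and>
     (\<forall>\<phi>. V \<phi> \<in> \<A>) \<and>
     (\<forall>\<phi>. V (Neg \<phi>) = W - V \<phi>) \<and>
     (\<forall>\<phi> \<psi>. V (Or \<phi> \<psi>) = V \<phi> \<union> V \<psi>) \<and>
     (\<forall>A\<in>\<A>. P A \<in> {0..1}) \<and>
     P {} = 0 \<and>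
     (\<forall>A\<in>\<A>. P (W - A) = 1 - P A) \<and>
     additive \<A> P"

definition upset :: "real set \<Rightarrow> bool" where
  "upset \<alpha> \<longleftrightarrow> \<alpha> \<subseteq> {0..1} \<and> 1 \<in> \<alpha> \<and> 0 \<notin> \<alpha> \<and> (\<forall>x y. x \<in> \<alpha> \<and> x \<le> y \<and> y \<le> 1 \<longrightarrow> y \<in> \<alpha>)"

(* A definition in HOL cannot quantify over all types of worlds, so a single type has to be chosen
   here, namely the type of truth assignments to the atoms; W ranges over arbitrary nonempty subsets
   of it, and V is not required to agree with the truth assignments. The choice is harmless:
   preservation_valid_in_all_models below shows that validity as defined here implies preservation
   in every model over every type of worlds. *)
definition preservation_valid :: "real set \<Rightarrow> form set \<Rightarrow> form set \<Rightarrow> bool" where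
  "preservation_valid \<alpha> \<Gamma> \<Delta> \<longleftrightarrow>
     (\<forall>(W :: (nat \<Rightarrow> bool) set) \<A> V P. probabilistic_model W \<A> V P \<longrightarrow>
        (\<forall>\<gamma>\<in>\<Gamma>. P (V \<gamma>) \<in> \<alpha>) \<longrightarrow> (\<exists>\<delta>\<in>\<Delta>. P (V \<delta>) \<in> \<alpha>))"

definition preservation_consequence :: "real set \<Rightarrow> (form set \<times> form set) set" where
  "preservation_consequence \<alpha> =
     {(\<Gamma>, \<Delta>). finite \<Gamma> \<and> finite \<Delta> \<and> preservation_valid \<alpha> \<Gamma> \<Delta>}"

definition preservation_consequence_relations :: "(form set \<times> form set) set set" where
  "preservation_consequence_relations = {preservation_consequence \<alpha> | \<alpha>. upset \<alpha>}"

definition incomparable :: "'a set \<Rightarrow> 'a set \<Rightarrow> bool" where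
  "incomparable C D \<longleftrightarrow> \<not> C \<subseteq> D \<and> \<not> D \<subseteq> C"

(* Every model is equivalent to one whose worlds are truth assignments: take the image measure
   under the map sending a world to the atoms true at it. *)
lemma probabilistic_model_valuations:
  fixes W :: "'w set"
  assumes "probabilistic_model W \<A> V P"
  shows "\<exists>(W' :: (nat \<Rightarrow> bool) set) \<A>' V' P'.
    probabilistic_model W' \<A>' V' P' \<and> (\<forall>\<phi>. P' (V' \<phi>) = P (V \<phi>))"
proof -
  define h where "h = (\<lambda>w n. w \<in> V (Atom n))"
  define pre where "pre = (\<lambda>B. {w\<in>W. h w \<in> B})"
  define W' where "W' = h ` W"
  define A' where "A' = {B. B \<subseteq> W' \<and> pre B \<in> \<A>}"
  define V' where "V' = (\<lambda>\<phi>. h ` V \<phi>)"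
  have m: "W \<noteq> {}" "algebra W \<A>" "\<And>\<phi>. V \<phi> \<in> \<A>" "\<And>\<phi>. V (Neg \<phi>) = W - V \<phi>"
    "\<And>\<phi> \<psi>. V (Or \<phi> \<psi>) = V \<phi> \<union> V \<psi>" "\<And>A. A \<in> \<A> \<Longrightarrow> P A \<in> {0..1}" "P {} = 0"
    "\<And>A. A \<in> \<A> \<Longrightarrow> P (W - A) = 1 - P A" "additive \<A> P"
    using assms unfolding probabilistic_model_def by auto
  have alg: "\<A> \<subseteq> Pow W" "{} \<in> \<A>" "\<And>a. a \<in> \<A> \<Longrightarrow> W - a \<in> \<A>"
    "\<And>a b. a \<in> \<A> \<Longrightarrow> b \<in> \<A> \<Longrightarrow> a \<union> b \<in> \<A>"
    using m(2) unfolding algebra_iff_Un by auto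
  have VW: "V \<phi> \<subseteq> W" for \<phi> using m(3) alg(1) by blast
  have inv: "w \<in> V \<phi> \<longleftrightarrow> w' \<in> V \<phi>" if "w \<in> W" "w' \<in> W" "h w = h w'" for w w' \<phi>
  proof (induction \<phi>)
    case (Atom n)
    show ?case using fun_cong[OF that(3), of n] by (simp add: h_def)
  next
    case (Neg \<phi>)
    then show ?case using that m(4) by auto
  next
    case (Or \<phi> \<psi>)
    then show ?case using m(5) by auto
  qed
  have mem: "h w \<in> V' \<phi> \<longleftrightarrow> w \<in> V \<phi>" if "w \<in> W" for w \<phi>
  proof
    assume "h w \<in> V' \<phi>"
    then obtain u where "u \<in> V \<phi>" "h w = h u" unfolding V'_def by (rule imageE)
    then show "w \<in> V \<phi>" using inv[OF that, of u \<phi>] VW[of \<phi>] by blast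
  qed (simp add: V'_def)
  have V'W: "V' \<phi> \<subseteq> W'" for \<phi>
    unfolding V'_def W'_def by (rule image_mono[OF VW])
  have preV: "pre (V' \<phi>) = V \<phi>" for \<phi>
    using VW[of \<phi>] mem[of _ \<phi>] unfolding pre_def by blast
  have preD: "pre (W' - B) = W - pre B" for B
    unfolding pre_def W'_def by auto
  have preU: "pre (B \<union> C) = pre B \<union> pre C" for B C
    unfolding pre_def by auto
  have pre0: "pre {} = {}" unfolding pre_def by auto
  have neg: "V' (Neg \<phi>) = W' - V' \<phi>" for \<phi>
  proof (rule set_eqI)
    fix v
    show "v \<in> V' (Neg \<phi>) \<longleftrightarrow> v \<in> W' - V' \<phi>"
    proof (cases "v \<in> W'")
      case True
      then obtain w where "w \<in> W" "v = h w" unfolding W'_def by blast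
      then show ?thesis using mem[of w] True m(4) by simp
    next
      case False
      then show ?thesis using V'W by blast
    qed
  qed
  have V'A: "V' \<phi> \<in> A'" for \<phi>
    unfolding A'_def using preV m(3) V'W by simp
  have "algebra W' A'"
    unfolding algebra_iff_Un A'_def using alg preD preU pre0 by auto
  moreover have "additive A' (\<lambda>B. P (pre B))"
    unfolding additive_def
  proof (intro ballI impI)
    fix B C assume "B \<in> A'" "C \<in> A'" "B \<inter> C = {}"
    moreover have "pre B \<inter> pre C = {}" using \<open>B \<inter> C = {}\<close> unfolding pre_def by auto
    ultimately show "P (pre (B \<union> C)) = P (pre B) + P (pre C)"
      using m(9) unfolding additive_def A'_def preU by auto
  qed
  moreover have "W' \<noteq> {}" using m(1) unfolding W'_def by auto
  moreover have "\<forall>\<phi> \<psi>. V' (Or \<phi> \<psi>) = V' \<phi> \<union> V' \<psi>"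
    unfolding V'_def m(5) by auto
  moreover have "\<forall>B\<in>A'. P (pre B) \<in> {0..1}" "\<forall>B\<in>A'. P (pre (W' - B)) = 1 - P (pre B)"
    using m(6,8) unfolding A'_def preD by blast+
  ultimately have "probabilistic_model W' A' V' (\<lambda>B. P (pre B))"
    unfolding probabilistic_model_def using V'A neg pre0 m(7) by auto
  moreover have "\<forall>\<phi>. P (pre (V' \<phi>)) = P (V \<phi>)" using preV by simp
  ultimately show ?thesis by (intro exI conjI)
qed

lemma preservation_valid_in_all_models:
  fixes W :: "'w set"
  assumes "preservation_valid \<alpha> \<Gamma> \<Delta>"
    and "probabilistic_model W \<A> V P"
    and "\<forall>\<gamma>\<in>\<Gamma>. P (V \<gamma>) \<in> \<alpha>"
  shows "\<exists>\<delta>\<in>\<Delta>. P (V \<delta>) \<in> \<alpha>"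
proof -
  obtain W' :: "(nat \<Rightarrow> bool) set" and \<A>' V' P'
    where "probabilistic_model W' \<A>' V' P'" and "\<forall>\<phi>. P' (V' \<phi>) = P (V \<phi>)"
    using probabilistic_model_valuations[OF assms(2)] by blast
  then have "(\<forall>\<gamma>\<in>\<Gamma>. P' (V' \<gamma>) \<in> \<alpha>) \<longrightarrow> (\<exists>\<delta>\<in>\<Delta>. P' (V' \<delta>) \<in> \<alpha>)"
    using assms(1) unfolding preservation_valid_def by blast
  with \<open>\<forall>\<phi>. P' (V' \<phi>) = P (V \<phi>)\<close> assms(3) show ?thesis by simp
qed

end

theory Submission
  imports Defs
begin

text \<open>
  For a rational \<open>b = m/n\<close>, take a partition into \<open>n\<close> cells and let \<open>\<Gamma>\<close> consist of the \<open>n\<close> cyclic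
  unions of \<open>m\<close> consecutive cells. Their probabilities average to \<open>b\<close> in every model, and all equal
  \<open>b\<close> in the uniform one. Hence the argument from \<open>\<Gamma>\<close> to the empty set is valid iff \<open>b \<notin> \<alpha>\<close>, and the
  argument from the empty set to \<open>\<Gamma>\<close> is valid iff \<open>b \<in> \<alpha>\<close>. So two upsets that differ at a rational
  have incomparable consequence relations, which also gives uncountability.

  Two different upsets with the same rational elements differ only at an irrational \<open>t\<close>. They have the
  same consequence relation: there is an additive \<open>f : \<real> \<rightarrow> \<real>\<close> with \<open>f 1 = 0\<close> and \<open>f t = 1\<close>, and
  replacing \<open>P\<close> by \<open>P \<plusminus> \<epsilon> f(P)\<close> on a finite algebra, with \<open>\<epsilon>\<close> small, pushes the value \<open>t\<close> to the
  desired side and leaves all other values on their side of \<open>t\<close>.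
\<close>

section \<open>Probabilistic models\<close>

lemma probabilistic_modelD:
  assumes "probabilistic_model W \<A> V P"
  shows "V \<phi> \<in> \<A>" "V \<phi> \<subseteq> W" "V (Neg \<phi>) = W - V \<phi>" "V (Or \<phi> \<psi>) = V \<phi> \<union> V \<psi>"
    "A \<in> \<A> \<Longrightarrow> 0 \<le> P A" "A \<in> \<A> \<Longrightarrow> P A \<le> 1" "P {} = 0" "A \<in> \<A> \<Longrightarrow> P (W - A) = 1 - P A"
    "additive \<A> P" "algebra W \<A>" "W \<noteq> {}"
  using assms unfolding probabilistic_model_def algebra_iff_Un by auto

lemma probability_disjoint_Or:
  assumes "probabilistic_model W \<A> V P" "V \<phi> \<inter> V \<psi> = {}"
  shows "P (V (Or \<phi> \<psi>)) = P (V \<phi>) + P (V \<psi>)"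
  using assms(2) probabilistic_modelD[OF assms(1)] unfolding additive_def by simp

text \<open>The language has no constant for falsum; a contradiction serves as the empty
  disjunction.\<close>

definition bot_form :: form where
  "bot_form = Neg (Or (Atom 0) (Neg (Atom 0)))"

primrec disjunction :: "form list \<Rightarrow> form" where
  "disjunction [] = bot_form"
| "disjunction (\<phi> # \<phi>s) = Or \<phi> (disjunction \<phi>s)"

lemma sem_bot_form:
  assumes "probabilistic_model W \<A> V P"
  shows "V bot_form = {}"
  using probabilistic_modelD(2)[OF assms]
  by (auto simp: bot_form_def probabilistic_modelD(3,4)[OF assms])

lemma sem_disj:
  assumes "probabilistic_model W \<A> V P"
  shows "V (disjunction \<phi>s) = (\<Union>\<phi>\<in>set \<phi>s. V \<phi>)"
  by (induction \<phi>s) (simp_all add: sem_bot_form[OF assms] probabilistic_modelD(4)[OF assms])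

lemma probability_disj:
  assumes "probabilistic_model W \<A> V P"
    and "distinct is" "disjoint_family_on (\<lambda>i. V (\<phi> i)) (set is)"
  shows "P (V (disjunction (map \<phi> is))) = (\<Sum>i\<in>set is. P (V (\<phi> i)))"
  using assms(2,3)
proof (induction "is")
  case Nil
  then show ?case by (simp add: sem_bot_form[OF assms(1)] probabilistic_modelD(7)[OF assms(1)])
next
  case (Cons i "is")
  have "V (\<phi> i) \<inter> V (disjunction (map \<phi> is)) = {}"
    using Cons.prems unfolding sem_disj[OF assms(1)] disjoint_family_on_def by fastforce
  moreover have "disjoint_family_on (\<lambda>i. V (\<phi> i)) (set is)"
    using Cons.prems(2) by (auto simp: disjoint_family_on_def)
  ultimately show ?case
    using Cons by (simp add: probability_disjoint_Or[OF assms(1)])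
qed

section \<open>Cyclic blocks of a partition\<close>

text \<open>A chain of sentences that increases with \<open>i\<close>, empty at 0 if
  \<open>n > 0\<close> and true at every world from \<open>i = n\<close> on. Taking a tautology at
  the end makes the successive differences exhaust \<open>W\<close> in every model.\<close>

definition initial :: "nat \<Rightarrow> nat \<Rightarrow> form" where
  "initial n i = (if i < n then disjunction (map Atom [0..<i]) else Neg bot_form)"

text \<open>The difference of two neighbours in the chain, written with \<open>Neg\<close> and
  \<open>Or\<close>. For \<open>Suc i < n\<close> it says that \<open>i\<close> is the first true
  atom; the last cell collects the worlds where no atom below \<open>n - 1\<close> is true.\<close>

definition cell :: "nat \<Rightarrow> nat \<Rightarrow> form" where
  "cell n i = Neg (Or (Neg (initial n (Suc i))) (initial n i))"

definition block :: "nat \<Rightarrow> nat \<Rightarrow> nat \<Rightarrow> form" where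
  "block n m i = disjunction (map (\<lambda>j. cell n ((i + j) mod n)) [0..<m])"

lemma sem_initial:
  assumes "probabilistic_model W \<A> V P"
  shows "V (initial n i) = (if i < n then (\<Union>j<i. V (Atom j)) else W)"
  by (auto simp: initial_def sem_disj[OF assms] sem_bot_form[OF assms] atLeast0LessThan
      probabilistic_modelD(3)[OF assms])

lemma sem_initial_mono:
  assumes "probabilistic_model W \<A> V P" "i \<le> j"
  shows "V (initial n i) \<subseteq> V (initial n j)"
  using probabilistic_modelD(2)[OF assms(1)] assms(2)
  by (fastforce simp: sem_initial[OF assms(1)])

lemma sem_cell:
  assumes "probabilistic_model W \<A> V P"
  shows "V (cell n i) = V (initial n (Suc i)) - V (initial n i)"
  using probabilistic_modelD(2)[OF assms]
  by (auto simp: cell_def probabilistic_modelD(3,4)[OF assms])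

text \<open>For \<open>i < j\<close>, cell \<open>i\<close> lies inside \<open>initial n j\<close>,
  which is removed from cell \<open>j\<close>.\<close>

lemma disjoint_cells:
  assumes "probabilistic_model W \<A> V P" "i \<noteq> j"
  shows "V (cell n i) \<inter> V (cell n j) = {}"
  using assms(2)
proof (induction i j rule: linorder_wlog)
  case (le i j)
  then have "V (initial n (Suc i)) \<subseteq> V (initial n j)"
    by (intro sem_initial_mono[OF assms(1)]) simp
  then show ?case by (auto simp: sem_cell[OF assms(1)])
qed (simp add: Int_commute)

lemma probability_cell:
  assumes "probabilistic_model W \<A> V P"
  shows "P (V (cell n i)) = P (V (initial n (Suc i))) - P (V (initial n i))"
proof -
  have "V (Or (cell n i) (initial n i)) = V (initial n (Suc i))"
    using sem_initial_mono[OF assms, of i "Suc i" n]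
    by (auto simp: sem_cell[OF assms] probabilistic_modelD(4)[OF assms])
  moreover have "V (cell n i) \<inter> V (initial n i) = {}"
    by (auto simp: sem_cell[OF assms])
  ultimately show ?thesis
    using probability_disjoint_Or[OF assms, of "cell n i" "initial n i"] by simp
qed

text \<open>The sum telescopes along the chain, from \<open>P {} = 0\<close> to
  \<open>P W = 1\<close>.\<close>

lemma sum_probability_cell:
  assumes "probabilistic_model W \<A> V P" "n > 0"
  shows "(\<Sum>i<n. P (V (cell n i))) = 1"
proof -
  have "P W = 1"
    using probabilistic_modelD(7)[OF assms(1)] probabilistic_modelD(8)[OF assms(1), of "{}"]
      algebra.axioms(1)[OF probabilistic_modelD(10)[OF assms(1)]]
    by (simp add: ring_of_sets_def semiring_of_sets_def semiring_of_sets_axioms_def)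
  moreover have "(\<Sum>i<n. P (V (cell n i))) = P (V (initial n n)) - P (V (initial n 0))"
    unfolding probability_cell[OF assms(1)] by (rule sum_lessThan_telescope)
  ultimately show ?thesis
    using assms(2) by (simp add: sem_initial[OF assms(1)] probabilistic_modelD(7)[OF assms(1)])
qed

text \<open>Used in two ways: a block does not repeat a cell, and a cyclic shift permutes the
  cells.\<close>

lemma mod_add_inj:
  fixes i j k n :: nat
  assumes "(i + j) mod n = (i + k) mod n" "j < n" "k < n"
  shows "j = k"
  using assms
proof (induction j k rule: linorder_wlog)
  case (le j k)
  then have "n dvd k - j"
    using mod_eq_dvd_iff_nat[of "i + j" "i + k" n] by simp
  then show ?case using le by (auto dest: dvd_imp_le)
qed simp

lemma probability_block:
  assumes "probabilistic_model W \<A> V P" "m \<le> n"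
  shows "P (V (block n m i)) = (\<Sum>j<m. P (V (cell n ((i + j) mod n))))"
proof -
  have "disjoint_family_on (\<lambda>j. V (cell n ((i + j) mod n))) (set [0..<m])"
    unfolding disjoint_family_on_def
    using disjoint_cells[OF assms(1)] mod_add_inj[of i _ n] assms(2)
    by (metis atLeastLessThan_iff less_le_trans set_upt)
  from probability_disj[OF assms(1) distinct_upt this] show ?thesis
    unfolding block_def by (simp add: atLeast0LessThan)
qed

text \<open>Double counting: after the sums are swapped, each of the \<open>m\<close> offsets runs
  once through all cells and contributes 1.\<close>

lemma sum_probability_block:
  assumes "probabilistic_model W \<A> V P" "m \<le> n" "n > 0"
  shows "(\<Sum>i<n. P (V (block n m i))) = real m"
proof -
  have "(\<Sum>i<n. P (V (cell n ((i + j) mod n)))) = 1" for j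
  proof -
    have "inj_on (\<lambda>i. (i + j) mod n) {..<n}"
      by (intro inj_onI, rule mod_add_inj[of j _ n]) (auto simp: add.commute)
    moreover have "(\<lambda>i. (i + j) mod n) ` {..<n} \<subseteq> {..<n}"
      using assms(3) by auto
    ultimately have "bij_betw (\<lambda>i. (i + j) mod n) {..<n} {..<n}"
      by (simp add: bij_betw_def endo_inj_surj)
    from sum.reindex_bij_betw[OF this, of "\<lambda>i. P (V (cell n i))"] show ?thesis
      using sum_probability_cell[OF assms(1,3)] by simp
  qed
  then show ?thesis
    unfolding probability_block[OF assms(1,2)] by (subst sum.swap) simp
qed

text \<open>Valuations of constructed models come from this recursion: the clauses for the
  connectives then hold by definition, and only the atoms are chosen.\<close>

primrec sem :: "'w set \<Rightarrow> (nat \<Rightarrow> 'w set) \<Rightarrow> form \<Rightarrow> 'w set" where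
  "sem W U (Atom n) = U n"
| "sem W U (Neg \<phi>) = W - sem W U \<phi>"
| "sem W U (Or \<phi> \<psi>) = sem W U \<phi> \<union> sem W U \<psi>"

lemma uniform_model:
  assumes "n > 0" "m \<le> n"
  shows "\<exists>(W :: nat set) \<A> V P. probabilistic_model W \<A> V P \<and>
    (\<forall>i. P (V (block n m i)) = real m / real n)"
proof -
  \<comment> \<open>Atom \<open>i\<close> is true exactly at world \<open>i\<close>, so each cell is
    a singleton under the counting measure. The intersection keeps the atoms from \<open>n\<close>
    on inside the space.\<close>
  define V where "V = sem {..<n} (\<lambda>i. {..<n} \<inter> {i})"
  define P where "P = (\<lambda>A. real (card (A :: nat set)) / real n)"
  have VW: "V \<phi> \<subseteq> {..<n}" for \<phi>
    unfolding V_def by (induction \<phi>) auto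
  have compl: "real (card ({..<n} - A)) = real n - real (card A)" if "A \<subseteq> {..<n}" for A
    using that card_mono[OF finite_lessThan that]
    by (simp add: card_Diff_subset finite_subset[OF that])
  have bound: "card A \<le> n" if "A \<subseteq> {..<n}" for A
    using card_mono[OF finite_lessThan that] by simp
  have m: "probabilistic_model {..<n} (Pow {..<n}) V P"
    unfolding probabilistic_model_def
  proof (intro conjI)
    show "{..<n} \<noteq> {}" using assms by auto
    show "algebra {..<n} (Pow {..<n})" by (rule algebra_Pow)
    show "additive (Pow {..<n}) P"
      unfolding additive_def P_def
      by (auto simp: card_Un_disjoint finite_subset[OF _ finite_lessThan] add_divide_distrib)
    show "\<forall>A\<in>Pow {..<n}. P A \<in> {0..1}" using assms bound by (auto simp: P_def)
    show "\<forall>A\<in>Pow {..<n}. P ({..<n} - A) = 1 - P A"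
      using assms(1) by (auto simp: P_def compl diff_divide_distrib)
    show "\<forall>\<phi>. V \<phi> \<in> Pow {..<n}" using VW by blast
  qed (simp_all add: V_def P_def)
  have "V (Atom j) = {..<n} \<inter> {j}" for j
    by (simp add: V_def)
  then have "V (initial n i) = {..<i}" if "i \<le> n" for i
    using that by (auto simp: sem_initial[OF m])
  then have "V (cell n i) = {i}" if "i < n" for i
    using that by (auto simp: sem_cell[OF m])
  then have "P (V (cell n i)) = 1 / real n" if "i < n" for i
    using that by (simp add: P_def)
  then have "\<forall>i. P (V (block n m i)) = real m / real n"
    using assms(1) by (simp add: probability_block[OF m assms(2)])
  with m show ?thesis by blast
qed

section \<open>Separating upsets by rational numbers\<close>

lemma upset_mem_mono: "upset \<alpha> \<Longrightarrow> x \<in> \<alpha> \<Longrightarrow> x \<le> y \<Longrightarrow> y \<le> 1 \<Longrightarrow> y \<in> \<alpha>"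
  unfolding upset_def by blast

lemma upset_bounds: "upset \<alpha> \<Longrightarrow> x \<in> \<alpha> \<Longrightarrow> 0 \<le> x \<and> x \<le> 1"
  unfolding upset_def by auto

text \<open>One \<open>\<Gamma>\<close> is fixed before the upset is given, so it can be used to
  compare two upsets.\<close>

lemma rational_separating_set:
  assumes "b \<in> \<rat>" "0 \<le> b" "b \<le> (1 :: real)"
  obtains \<Gamma> where "\<And>\<alpha>. upset \<alpha> \<Longrightarrow> (\<Gamma>, {}) \<in> preservation_consequence \<alpha> \<longleftrightarrow> b \<notin> \<alpha>"
    and "\<And>\<alpha>. upset \<alpha> \<Longrightarrow> ({}, \<Gamma>) \<in> preservation_consequence \<alpha> \<longleftrightarrow> b \<in> \<alpha>"
proof -
  obtain m n :: nat where n: "n > 0" and b: "b = real m / real n"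
    using Rats_abs_nat_div_natE[OF assms(1)] assms(2) by (metis abs_of_nonneg gr0I)
  have mn: "m \<le> n" using assms(3) n b by simp
  define \<Gamma> where "\<Gamma> = block n m ` {..<n}"
  have fin: "finite \<Gamma>" by (simp add: \<Gamma>_def)
  have nb: "real m = real n * b" using n b by simp
  obtain W :: "nat set" and \<A> V P where M: "probabilistic_model W \<A> V P"
    and u: "\<And>i. P (V (block n m i)) = b"
    using uniform_model[OF n mn] b by blast
  \<comment> \<open>The block probabilities have average \<open>b\<close>, so they cannot all lie
    strictly above or strictly below it.\<close>
  have le: "\<exists>i<n. P (V (block n m i)) \<le> b" and ge: "\<exists>i<n. b \<le> P (V (block n m i))"
    if "probabilistic_model W \<A> V P"
    for W :: "(nat \<Rightarrow> bool) set" and \<A> V P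
  proof -
    note s = sum_probability_block[OF that mn n]
    show "\<exists>i<n. P (V (block n m i)) \<le> b"
    proof (rule ccontr)
      assume "\<not> ?thesis"
      then have "(\<Sum>i<n. b) < (\<Sum>i<n. P (V (block n m i)))"
        using n by (intro sum_strict_mono) (auto simp: not_le)
      then show False using s nb by simp
    qed
    show "\<exists>i<n. b \<le> P (V (block n m i))"
    proof (rule ccontr)
      assume "\<not> ?thesis"
      then have "(\<Sum>i<n. P (V (block n m i))) < (\<Sum>i<n. b)"
        using n by (intro sum_strict_mono) (auto simp: not_le)
      then show False using s nb by simp
    qed
  qed
  have "(\<Gamma>, {}) \<in> preservation_consequence \<alpha> \<longleftrightarrow> b \<notin> \<alpha>" if \<alpha>: "upset \<alpha>" for \<alpha>
  proof
    assume "(\<Gamma>, {}) \<in> preservation_consequence \<alpha>"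
    then have "preservation_valid \<alpha> \<Gamma> {}" by (simp add: preservation_consequence_def)
    \<comment> \<open>The uniform model has natural numbers as worlds, hence the passage to models
      over any type.\<close>
    from preservation_valid_in_all_models[OF this M] show "b \<notin> \<alpha>"
      by (auto simp: \<Gamma>_def u)
  next
    assume "b \<notin> \<alpha>"
    then have "\<exists>\<gamma>\<in>\<Gamma>. P (V \<gamma>) \<notin> \<alpha>" if "probabilistic_model W \<A> V P"
      for W :: "(nat \<Rightarrow> bool) set" and \<A> V P
      using le[OF that] upset_mem_mono[OF \<alpha>] assms(3) unfolding \<Gamma>_def by blast
    then show "(\<Gamma>, {}) \<in> preservation_consequence \<alpha>"
      using fin unfolding preservation_consequence_def preservation_valid_def by blast
  qed
  moreover have "({}, \<Gamma>) \<in> preservation_consequence \<alpha> \<longleftrightarrow> b \<in> \<alpha>" if \<alpha>: "upset \<alpha>" for \<alpha>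
  proof
    assume "({}, \<Gamma>) \<in> preservation_consequence \<alpha>"
    then have "preservation_valid \<alpha> {} \<Gamma>" by (simp add: preservation_consequence_def)
    from preservation_valid_in_all_models[OF this M] show "b \<in> \<alpha>"
      by (auto simp: \<Gamma>_def u)
  next
    assume "b \<in> \<alpha>"
    then have "\<exists>\<gamma>\<in>\<Gamma>. P (V \<gamma>) \<in> \<alpha>" if "probabilistic_model W \<A> V P"
      for W :: "(nat \<Rightarrow> bool) set" and \<A> V P
      \<comment> \<open>Upsets are closed upwards only as far as 1, so the bound
        \<open>P \<le> 1\<close> is supplied too.\<close>
      using ge[OF that] upset_mem_mono[OF \<alpha>]
        probabilistic_modelD(6)[OF that probabilistic_modelD(1)[OF that]]
      unfolding \<Gamma>_def by blast
    then show "({}, \<Gamma>) \<in> preservation_consequence \<alpha>"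
      using fin unfolding preservation_consequence_def preservation_valid_def by blast
  qed
  ultimately show thesis by (rule that)
qed

text \<open>For the same \<open>\<Gamma>\<close>, the argument with empty conclusions is valid for
  \<open>\<beta>\<close> alone and the one with empty premises for \<open>\<alpha>\<close>
  alone.\<close>

lemma incomparable_if_differ_at_rational:
  assumes "upset \<alpha>" "upset \<beta>" "b \<in> \<rat>" "b \<in> \<alpha>" "b \<notin> \<beta>"
  shows "incomparable (preservation_consequence \<alpha>) (preservation_consequence \<beta>)"
proof -
  have "0 \<le> b" "b \<le> 1" using upset_bounds[OF assms(1,4)] by auto
  from rational_separating_set[OF assms(3) this]
  obtain \<Gamma> where "\<And>\<alpha>. upset \<alpha> \<Longrightarrow> (\<Gamma>, {}) \<in> preservation_consequence \<alpha> \<longleftrightarrow> b \<notin> \<alpha>"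
    and "\<And>\<alpha>. upset \<alpha> \<Longrightarrow> ({}, \<Gamma>) \<in> preservation_consequence \<alpha> \<longleftrightarrow> b \<in> \<alpha>" by blast
  then show ?thesis using assms unfolding incomparable_def by blast
qed

section \<open>Upsets with the same rational elements\<close>

interpretation rat_real: vector_space "\<lambda>(q :: rat) (x :: real). of_rat q * x"
  by unfold_locales (simp_all add: algebra_simps of_rat_add of_rat_mult)

interpretation rat_real_pair: vector_space_pair
  "\<lambda>(q :: rat) (x :: real). of_rat q * x" "\<lambda>(q :: rat) (x :: real). of_rat q * x"
  by unfold_locales

text \<open>The rational span of 1 is the set of rationals, so \<open>t\<close> and 1 are linearly
  independent and their values can be prescribed for a linear map.\<close>

lemma additive_function_separating_irrational:
  assumes "t \<notin> \<rat>"
  obtains f :: "real \<Rightarrow> real"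
  where "\<And>x y. f (x + y) = f x + f y" "f 1 = 0" "f t = 1"
proof -
  have t1: "t \<noteq> 1" using assms by auto
  have "t \<notin> rat_real.span {1}"
    using assms unfolding rat_real.span_singleton by (auto simp: image_iff)
  then have "rat_real.independent {t, 1}"
    using t1 rat_real.independent_insertI[of t "{1}"] by (simp add: rat_real.independent_insert)
  from rat_real_pair.linear_independent_extend[OF this, of "\<lambda>x. if x = t then 1 else 0"]
  obtain f :: "real \<Rightarrow> real" where f: "Vector_Spaces.linear (\<lambda>q. (*) (of_rat q)) (\<lambda>q. (*) (of_rat q)) f"
    "\<forall>x\<in>{t, 1}. f x = (if x = t then 1 else 0)"
    by blast
  have "f (x + y) = f x + f y" for x y
    using f(1) by (rule rat_real_pair.linear_add)
  then show thesis using f(2) t1 by (intro that[of f]) auto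
qed

section \<open>Reduction to finite algebras\<close>

primrec atoms :: "form \<Rightarrow> nat set" where
  "atoms (Atom n) = {n}"
| "atoms (Neg \<phi>) = atoms \<phi>"
| "atoms (Or \<phi> \<psi>) = atoms \<phi> \<union> atoms \<psi>"

lemma finite_atoms [simp]: "finite (atoms \<phi>)"
  by (induction \<phi>) auto

text \<open>A world matters only through the set \<open>h w\<close> of atoms true at it, a subset of
  the finite set \<open>K\<close>. Each sentence therefore denotes the preimage under
  \<open>h\<close> of one of finitely many families of subsets of \<open>K\<close>.\<close>

lemma finite_range_sem:
  assumes "finite {n. U n \<noteq> {}}" "\<And>n. U n \<subseteq> W"
  shows "finite (range (sem W U))"
proof -
  define K where "K = {n. U n \<noteq> {}}"
  define h where "h = (\<lambda>w. {n. w \<in> U n})"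
  have "\<exists>S \<in> Pow (Pow K). sem W U \<phi> = {w\<in>W. h w \<in> S}" for \<phi>
  proof (induction \<phi>)
    case (Atom n)
    have "sem W U (Atom n) = {w\<in>W. h w \<in> {L. L \<subseteq> K \<and> n \<in> L}}"
      using assms(2) by (auto simp: h_def K_def)
    then show ?case by blast
  next
    case (Neg \<phi>)
    then obtain S where S: "S \<in> Pow (Pow K)" "sem W U \<phi> = {w\<in>W. h w \<in> S}" by blast
    have "sem W U (Neg \<phi>) = {w\<in>W. h w \<in> Pow K - S}"
      using S by (auto simp: h_def K_def)
    then show ?case by blast
  next
    case (Or \<phi> \<psi>)
    from Or.IH(1) obtain S where S: "S \<in> Pow (Pow K)" "sem W U \<phi> = {w\<in>W. h w \<in> S}" ..
    from Or.IH(2) obtain T where T: "T \<in> Pow (Pow K)" "sem W U \<psi> = {w\<in>W. h w \<in> T}" ..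
    have "sem W U (Or \<phi> \<psi>) = {w\<in>W. h w \<in> S \<union> T}" using S T by auto
    then show ?case using S(1) T(1) by (intro bexI[of _ "S \<union> T"]) auto
  qed
  then have "range (sem W U) \<subseteq> (\<lambda>S. {w\<in>W. h w \<in> S}) ` Pow (Pow K)"
    by (intro image_subsetI) (simp only: image_iff)
  moreover have "finite (Pow (Pow K))" using assms(1) by (simp add: K_def)
  ultimately show ?thesis by (rule finite_surj[rotated])
qed

text \<open>Prepares the perturbation, which needs one \<open>\<epsilon>\<close> that is small
  enough for every set of the algebra.\<close>

lemma finite_submodel:
  assumes M: "probabilistic_model W \<A> V P" and "finite \<Phi>"
  obtains \<B> V' where "probabilistic_model W \<B> V' P" "finite \<B>" "\<And>\<phi>. \<phi> \<in> \<Phi> \<Longrightarrow> V' \<phi> = V \<phi>"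
proof -
  note D = probabilistic_modelD[OF M]
  define K where "K = (\<Union>\<phi>\<in>\<Phi>. atoms \<phi>)"
  have K: "finite K" using assms(2) by (simp add: K_def)
  \<comment> \<open>Atoms that do not occur in \<open>\<Phi>\<close> are made false everywhere,
    which leaves finitely many denotations; these form the new algebra.\<close>
  define U where "U = (\<lambda>n. if n \<in> K then V (Atom n) else {})"
  define V' where "V' = sem W U"
  have "finite {n. U n \<noteq> {}}"
    by (rule finite_subset[OF _ K]) (auto simp: U_def)
  then have fin: "finite (range V')"
    unfolding V'_def using D(2) by (intro finite_range_sem) (auto simp: U_def)
  have A: "{} \<in> \<A>" "\<And>A. A \<in> \<A> \<Longrightarrow> W - A \<in> \<A>" "\<And>A B. A \<in> \<A> \<Longrightarrow> B \<in> \<A> \<Longrightarrow> A \<union> B \<in> \<A>"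
    "\<A> \<subseteq> Pow W"
    using D(10) unfolding algebra_iff_Un by auto
  have V'A: "V' \<phi> \<in> \<A>" for \<phi>
    unfolding V'_def by (induction \<phi>) (auto simp: U_def A D(1))
  have neg: "V' (Neg \<phi>) = W - V' \<phi>" and or: "V' (Or \<phi> \<psi>) = V' \<phi> \<union> V' \<psi>" for \<phi> \<psi>
    by (simp_all add: V'_def)
  have "V' bot_form = {}"
    using V'A A(4) by (auto simp: bot_form_def neg or)
  then have empty: "{} \<in> range V'" using rangeI[of V' bot_form] by simp
  have diff: "W - A \<in> range V'" if "A \<in> range V'" for A
    using that by (auto simp flip: neg)
  have union: "A \<union> B \<in> range V'" if "A \<in> range V'" "B \<in> range V'" for A B
    using that by (auto simp flip: or)
  have "range V' \<subseteq> Pow W" using V'A A(4) by blast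
  with empty have "algebra W (range V')"
    unfolding algebra_iff_Un by (intro conjI ballI diff union)
  moreover have "additive (range V') P"
    using D(9) V'A unfolding additive_def by blast
  ultimately have "probabilistic_model W (range V') V' P"
    unfolding probabilistic_model_def using D(5-8,11) V'A neg or by auto
  moreover have "V' \<phi> = V \<phi>" if "\<phi> \<in> \<Phi>" for \<phi>
  proof -
    have "atoms \<psi> \<subseteq> K \<Longrightarrow> V' \<psi> = V \<psi>" for \<psi>
      unfolding V'_def by (induction \<psi>) (simp_all add: U_def D(3,4))
    then show ?thesis using that by (auto simp: K_def)
  qed
  ultimately show thesis using fin that by blast
qed

section \<open>Perturbing a probability by an additive function\<close>

text \<open>Additivity of \<open>f\<close> preserves that of \<open>P\<close>, and
  \<open>f 1 = 0\<close> preserves the complement rule. Value 0 stays 0 because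
  \<open>f 0 = 0\<close>, and the finitely many positive values stay positive for small
  \<open>\<epsilon>\<close>; the bound by 1 follows by complements.\<close>

lemma perturbed_model:
  assumes M: "probabilistic_model W \<A> V P" and "finite \<A>"
    and f: "\<And>x y :: real. f (x + y) = f x + f y" "f 1 = (0 :: real)"
  shows "eventually (\<lambda>\<epsilon>. probabilistic_model W \<A> V (\<lambda>A. P A + \<epsilon> * f (P A))) (at_right 0)"
proof -
  note D = probabilistic_modelD[OF M]
  have f0: "f 0 = 0" using f(1)[of 0 0] by simp
  have fc: "f (1 - x) = - f x" for x using f(1)[of x "1 - x"] f(2) by simp
  have "eventually (\<lambda>\<epsilon>. 0 \<le> P A + \<epsilon> * f (P A)) (at_right 0)" if "A \<in> \<A>" for A
  proof (cases "P A = 0")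
    case False
    then have "P A > 0" using D(5)[OF that] by simp
    moreover have "((\<lambda>\<epsilon>. P A + \<epsilon> * f (P A)) \<longlongrightarrow> P A + 0 * f (P A)) (at_right 0)"
      by (intro tendsto_intros)
    ultimately have "eventually (\<lambda>\<epsilon>. 0 < P A + \<epsilon> * f (P A)) (at_right 0)"
      by (intro order_tendstoD(1)) auto
    then show ?thesis by eventually_elim simp
  qed (simp add: f0)
  with assms(2) have "eventually (\<lambda>\<epsilon>. \<forall>A\<in>\<A>. 0 \<le> P A + \<epsilon> * f (P A)) (at_right 0)"
    by (intro eventually_ball_finite) auto
  then show ?thesis
  proof eventually_elim
    case (elim \<epsilon>)
    have compl: "P (W - A) + \<epsilon> * f (P (W - A)) = 1 - (P A + \<epsilon> * f (P A))" if "A \<in> \<A>" for A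
      using D(8)[OF that] by (simp add: fc)
    have "W - A \<in> \<A>" if "A \<in> \<A>" for A
      using that D(10) unfolding algebra_iff_Un by blast
    then have "P A + \<epsilon> * f (P A) \<le> 1" if "A \<in> \<A>" for A
      using elim compl[OF that] that by fastforce
    moreover have "additive \<A> (\<lambda>A. P A + \<epsilon> * f (P A))"
      using D(9) unfolding additive_def by (simp add: f(1) algebra_simps)
    ultimately show ?case
      unfolding probabilistic_model_def using D elim compl by (simp add: f0)
  qed
qed

text \<open>A rational strictly between \<open>t\<close> and \<open>x\<close> lies in both upsets or
  in neither, and decides membership of \<open>x\<close> for both.\<close>

lemma upset_differ_at_most_once:
  assumes "upset \<alpha>" "upset \<beta>" "\<alpha> \<inter> \<rat> = \<beta> \<inter> \<rat>" "t \<in> \<alpha>" "t \<notin> \<beta>" "x \<le> 1"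
  shows "t < x \<Longrightarrow> x \<in> \<alpha> \<and> x \<in> \<beta>" "x < t \<Longrightarrow> x \<notin> \<alpha> \<and> x \<notin> \<beta>"
proof -
  have t: "t \<le> 1" using upset_bounds[OF assms(1,4)] by simp
  show "x \<in> \<alpha> \<and> x \<in> \<beta>" if tx: "t < x"
  proof -
    obtain r where r: "r \<in> \<rat>" "t < r" "r < x" using Rats_dense_in_real[OF tx] by blast
    then have "r \<in> \<alpha>" using upset_mem_mono[OF assms(1,4), of r] assms(6) by simp
    then have "r \<in> \<beta>" using r assms(3) by blast
    then show ?thesis using upset_mem_mono[OF assms(1) \<open>r \<in> \<alpha>\<close>, of x]
        upset_mem_mono[OF assms(2) \<open>r \<in> \<beta>\<close>, of x] r assms(6) by simp
  qed
  show "x \<notin> \<alpha> \<and> x \<notin> \<beta>" if xt: "x < t"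
  proof -
    obtain r where r: "r \<in> \<rat>" "x < r" "r < t" using Rats_dense_in_real[OF xt] by blast
    then have "r \<notin> \<beta>" using upset_mem_mono[OF assms(2), of r t] assms(5) t by auto
    then have "r \<notin> \<alpha>" using r assms(3) by blast
    then show ?thesis using upset_mem_mono[OF assms(1), of x r]
        upset_mem_mono[OF assms(2), of x r] \<open>r \<notin> \<beta>\<close> r t by auto
  qed
qed

text \<open>A model for \<open>\<alpha>\<close> is turned into one for \<open>\<beta>\<close> in
  which the same sentences of \<open>\<Gamma>\<close> and \<open>\<Delta>\<close> reach the upset,
  so validity for \<open>\<beta>\<close> can be applied there.\<close>

lemma preservation_valid_if_perturbation:
  assumes valid: "preservation_valid \<beta> \<Gamma> \<Delta>" and fin: "finite \<Gamma>" "finite \<Delta>"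
    and f: "\<And>x y :: real. f (x + y) = f x + f y" "f 1 = (0 :: real)"
    and move: "\<And>x. x \<in> {0..1} \<Longrightarrow> eventually
      (\<lambda>\<epsilon>. x + \<epsilon> * f x \<le> 1 \<longrightarrow> (x + \<epsilon> * f x \<in> \<beta> \<longleftrightarrow> x \<in> \<alpha>)) (at_right 0)"
  shows "preservation_valid \<alpha> \<Gamma> \<Delta>"
  unfolding preservation_valid_def
proof (intro allI impI)
  fix W :: "(nat \<Rightarrow> bool) set" and \<A> V P
  assume "probabilistic_model W \<A> V P" and \<Gamma>: "\<forall>\<gamma>\<in>\<Gamma>. P (V \<gamma>) \<in> \<alpha>"
  then obtain \<B> V' where M: "probabilistic_model W \<B> V' P" and \<B>: "finite \<B>"
    and V': "\<And>\<phi>. \<phi> \<in> \<Gamma> \<union> \<Delta> \<Longrightarrow> V' \<phi> = V \<phi>"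
    using finite_submodel[of W \<A> V P "\<Gamma> \<union> \<Delta>"] fin by blast
  note D = probabilistic_modelD[OF M]
  have "eventually (\<lambda>\<epsilon>. \<forall>A\<in>\<B>. P A + \<epsilon> * f (P A) \<le> 1 \<longrightarrow>
      (P A + \<epsilon> * f (P A) \<in> \<beta> \<longleftrightarrow> P A \<in> \<alpha>)) (at_right 0)"
    using \<B> D(5,6) by (intro eventually_ball_finite ballI move) auto
  with perturbed_model[OF M \<B> f]
  have "eventually (\<lambda>\<epsilon>. probabilistic_model W \<B> V' (\<lambda>A. P A + \<epsilon> * f (P A)) \<and>
    (\<forall>A\<in>\<B>. P A + \<epsilon> * f (P A) \<le> 1 \<longrightarrow>
      (P A + \<epsilon> * f (P A) \<in> \<beta> \<longleftrightarrow> P A \<in> \<alpha>))) (at_right 0)"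
    by (rule eventually_conj)
  then obtain \<epsilon> where M': "probabilistic_model W \<B> V' (\<lambda>A. P A + \<epsilon> * f (P A))"
    and "\<forall>A\<in>\<B>. P A + \<epsilon> * f (P A) \<le> 1 \<longrightarrow> (P A + \<epsilon> * f (P A) \<in> \<beta> \<longleftrightarrow> P A \<in> \<alpha>)"
    using eventually_happens'[OF trivial_limit_at_right_real] by blast
  \<comment> \<open>The guard \<open>\<le> 1\<close> is met since the perturbed function is itself a
    probability.\<close>
  then have iff: "P (V' \<phi>) + \<epsilon> * f (P (V' \<phi>)) \<in> \<beta> \<longleftrightarrow> P (V' \<phi>) \<in> \<alpha>" for \<phi>
    using probabilistic_modelD(1,6)[OF M'] by blast
  have "P (V' \<gamma>) + \<epsilon> * f (P (V' \<gamma>)) \<in> \<beta>" if "\<gamma> \<in> \<Gamma>" for \<gamma>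
    using iff[of \<gamma>] \<Gamma> V'[of \<gamma>] that by simp
  then obtain \<delta> where "\<delta> \<in> \<Delta>" "P (V' \<delta>) + \<epsilon> * f (P (V' \<delta>)) \<in> \<beta>"
    using valid[unfolded preservation_valid_def, rule_format, OF M'] by blast
  then show "\<exists>\<delta>\<in>\<Delta>. P (V \<delta>) \<in> \<alpha>"
    using iff[of \<delta>] V'[of \<delta>] by auto
qed

lemma preservation_valid_transfer:
  assumes \<alpha>: "upset \<alpha>" and \<beta>: "upset \<beta>" and rat: "\<alpha> \<inter> \<rat> = \<beta> \<inter> \<rat>"
    and valid: "preservation_valid \<beta> \<Gamma> \<Delta>" and fin: "finite \<Gamma>" "finite \<Delta>"
  shows "preservation_valid \<alpha> \<Gamma> \<Delta>"
proof (cases "\<alpha> = \<beta>")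
  case False
  then obtain t where t: "t \<in> \<alpha> \<and> t \<notin> \<beta> \<or> t \<in> \<beta> \<and> t \<notin> \<alpha>" by blast
  then have "t \<notin> \<rat>" using rat by blast
  then obtain f :: "real \<Rightarrow> real"
    where f: "\<And>x y. f (x + y) = f x + f y" "f 1 = 0" "f t = 1"
    by (rule additive_function_separating_irrational) blast
  \<comment> \<open>The value \<open>t\<close> has to change sides: upwards into
    \<open>\<beta>\<close> if \<open>t\<close> lies in \<open>\<alpha>\<close> only, downwards out
    of \<open>\<beta>\<close> if it lies in \<open>\<beta>\<close> only.\<close>
  define s :: real where "s = (if t \<in> \<alpha> then 1 else -1)"
  have above: "x \<in> \<alpha> \<and> x \<in> \<beta>" if "t < x" "x \<le> 1" for x
    using t upset_differ_at_most_once(1)[OF \<alpha> \<beta> rat, of t x]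
      upset_differ_at_most_once(1)[OF \<beta> \<alpha> rat[symmetric], of t x] that by blast
  have t1: "t \<le> 1" using t upset_bounds \<alpha> \<beta> by blast
  have below: "x \<notin> \<alpha> \<and> x \<notin> \<beta>" if "x < t" for x
    using t upset_differ_at_most_once(2)[OF \<alpha> \<beta> rat, of t x]
      upset_differ_at_most_once(2)[OF \<beta> \<alpha> rat[symmetric], of t x] that t1 by force
  show ?thesis
  proof (rule preservation_valid_if_perturbation[OF valid fin, of "\<lambda>x. s * f x"])
    show "s * f (x + y) = s * f x + s * f y" for x y by (simp add: f(1) distrib_left)
    show "s * f 1 = 0" by (simp add: f(2))
    fix x :: real assume x: "x \<in> {0..1}"
    \<comment> \<open>For fixed \<open>x\<close> the expression is affine in
      \<open>\<epsilon>\<close>, so it tends to \<open>x\<close> however irregular \<open>f\<close>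
      is. Hence a value other than \<open>t\<close> eventually stays on its side of
      \<open>t\<close>.\<close>
    have lim: "((\<lambda>\<epsilon>. x + \<epsilon> * (s * f x)) \<longlongrightarrow> x) (at_right 0)"
    proof -
      have "((\<lambda>\<epsilon>. x + \<epsilon> * (s * f x)) \<longlongrightarrow> x + 0 * (s * f x)) (at_right 0)"
        by (intro tendsto_intros)
      then show ?thesis by simp
    qed
    consider "x < t" | "x = t" | "t < x" by linarith
    then show "eventually (\<lambda>\<epsilon>. x + \<epsilon> * (s * f x) \<le> 1 \<longrightarrow>
      (x + \<epsilon> * (s * f x) \<in> \<beta> \<longleftrightarrow> x \<in> \<alpha>)) (at_right 0)"
    proof cases
      case 1
      from order_tendstoD(2)[OF lim 1] show ?thesis
        by eventually_elim (use below 1 in blast)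
    next
      case 2
      have "eventually (\<lambda>\<epsilon>::real. \<epsilon> > 0) (at_right 0)"
        by (rule eventually_at_right_less)
      then show ?thesis
      proof eventually_elim
        case (elim \<epsilon>)
        then show ?case
          using t above[of "t + \<epsilon>"] below[of "t - \<epsilon>"] by (auto simp: 2 s_def f(3))
      qed
    next
      case 3
      from order_tendstoD(1)[OF lim 3] show ?thesis
        by eventually_elim (use above 3 x in auto)
    qed
  qed
qed (use valid in simp)

lemma preservation_consequence_eqI:
  assumes "upset \<alpha>" "upset \<beta>" "\<alpha> \<inter> \<rat> = \<beta> \<inter> \<rat>"
  shows "preservation_consequence \<alpha> = preservation_consequence \<beta>"
  using preservation_valid_transfer[OF assms] preservation_valid_transfer[OF assms(2,1) assms(3)[symmetric]]
  unfolding preservation_consequence_def by blast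

lemma incomparable_sym: "incomparable C D \<Longrightarrow> incomparable D C"
  unfolding incomparable_def by blast

section \<open>Uncountability and incomparability\<close>

lemma uncountable_preservation_consequence_relations:
  "uncountable preservation_consequence_relations"
proof -
  define C where "C = (\<lambda>t :: real. preservation_consequence {t<..1})"
  have up: "upset {t<..1}" if "t \<in> {0<..<1}" for t :: real
    using that by (auto simp: upset_def)
  have "C s \<noteq> C t" if "s \<in> {0<..<1}" "t \<in> {0<..<1}" "s < t" for s t
  proof -
    \<comment> \<open>This rational lies in the upset above \<open>s\<close> but not in the one
      above \<open>t\<close>; so \<open>C\<close> is injective on an uncountable interval.\<close>
    obtain r where "r \<in> \<rat>" "s < r" "r < t" using Rats_dense_in_real[OF \<open>s < t\<close>] by blast
    then have "incomparable (C s) (C t)"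
      unfolding C_def using that
      by (intro incomparable_if_differ_at_rational[OF up up, of s t r]) auto
    then show ?thesis unfolding incomparable_def by blast
  qed
  then have "inj_on C {0<..<1}"
    by (intro linorder_inj_onI) auto
  then have "uncountable (C ` {0<..<1})"
    using countable_image_inj_on uncountable_open_interval[of 0 "1 :: real"] by auto
  moreover have "C ` {0<..<1} \<subseteq> preservation_consequence_relations"
    using up unfolding C_def preservation_consequence_relations_def by blast
  ultimately show ?thesis using countable_subset by blast
qed

theorem corollary33:
  shows "uncountable preservation_consequence_relations \<and>
    (\<forall>C\<in>preservation_consequence_relations. \<forall>D\<in>preservation_consequence_relations.
       C \<noteq> D \<longrightarrow> incomparable C D)"
proof (intro conjI ballI impI)
  show "uncountable preservation_consequence_relations"
    by (rule uncountable_preservation_consequence_relations)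
  fix C D
  assume "C \<in> preservation_consequence_relations" "D \<in> preservation_consequence_relations"
    and "C \<noteq> D"
  then obtain \<alpha> \<beta> where up: "upset \<alpha>" "upset \<beta>"
    and CD: "C = preservation_consequence \<alpha>" "D = preservation_consequence \<beta>"
    unfolding preservation_consequence_relations_def by blast
  \<comment> \<open>Equal rational parts would force equal relations, so distinct relations supply a
    rational at which the upsets differ.\<close>
  have "\<alpha> \<inter> \<rat> \<noteq> \<beta> \<inter> \<rat>"
    using preservation_consequence_eqI[OF up] \<open>C \<noteq> D\<close> CD by auto
  then obtain b where "b \<in> \<rat>" "b \<in> \<alpha> \<and> b \<notin> \<beta> \<or> b \<in> \<beta> \<and> b \<notin> \<alpha>" by blast
  then show "incomparable C D"
    unfolding CD
    using incomparable_if_differ_at_rational[OF up, of b]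
      incomparable_sym[OF incomparable_if_differ_at_rational[OF up(2,1), of b]] by blast
qed

end
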